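(* Let $f:\mathbb{R}\to\mathbb{R}$ be continuous with $f(0)=0$ and $xf(x)>0$ for all $x\neq 0$. Suppose that there exists an odd function $\phi$ on $\mathbb{R}$ such that $\lim_{x\to 0} f(x)/\phi(x)=1$, that $f\in \mathrm{RV}_0(\beta)$ for some $\beta>1$, and that $\lim_{x\to 0^+} f(x)/x=0$. Let $\gamma:[0,\infty)\to\mathbb{R}$ be continuous with $$\lim_{t\to\infty}\frac{\gamma(t)}{F^{-1}(t)}=0.$$ Let $x$ be a continuous solution on $[0,\infty)$ of $$x'(t)=-f(x(t)+\gamma(t)),\quad t>0;\qquad x(0)=\xi\in\mathbb{R},$$ and suppose that $\lim_{t\to\infty}x(t)=0$. Then $\lim_{t\to\infty} |x(t)|/F^{-1}(t)$ exists and $$\lim_{t\to\infty}\frac{|x(t)|}{F^{-1}(t)}=0 \ \text{ or }\ 1.$$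
   Context: A function $f$ which is positive and measurable on $(0,\infty)$ is regularly varying at $0$ with index $\beta\in\mathbb{R}$, written $f\in\mathrm{RV}_0(\beta)$, if $\lim_{x\to0^+} f(\lambda x)/f(x)=\lambda^\beta$ for every $\lambda>0$ (for $f$ defined on $\mathbb{R}$ this refers to its restriction to $(0,\infty)$). Define $F(x)=\int_x^1 \frac{1}{f(u)}\,du$ for $x>0$. $F$ is strictly decreasing; since $\beta>1$, $F(x)\to\infty$ as $x\to0^+$. $F^{-1}$ denotes the inverse function of $F$; $F^{-1}(t)>0$ is defined for all $t\ge 0$ and tends to $0$ as $t\to\infty$. *)

theory Defs
  imports "HOL-Analysis.Analysis"
begin

definition regularly_varying_at_0 :: "(real \<Rightarrow> real) \<Rightarrow> real \<Rightarrow> bool" where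
  "regularly_varying_at_0 f \<beta> \<longleftrightarrow>
     (\<forall>x>0. f x > 0) \<and>
     f \<in> borel_measurable (lebesgue_on {0<..}) \<and>
     (\<forall>c>0. ((\<lambda>x. f (c * x) / f x) \<longlongrightarrow> c powr \<beta>) (at_right 0))"

text \<open>The interval integral is oriented: for positive continuous \<open>f\<close> the value is negative when
  \<open>x > 1\<close>, so the function is strictly decreasing on the whole half-line \<open>(0, \<infinity>)\<close>.\<close>

definition recip_integral :: "(real \<Rightarrow> real) \<Rightarrow> real \<Rightarrow> real" where
  "recip_integral f x = (LBINT u=x..1. 1 / f u)"

text \<open>The inverse of the restriction of \<open>recip_integral f\<close> to \<open>(0, \<infinity>)\<close>; it is meaningful
  only at points of the range of that restriction.\<close>

definition recip_integral_inv :: "(real \<Rightarrow> real) \<Rightarrow> real \<Rightarrow> real" where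
  "recip_integral_inv f = inv_into {0<..} (recip_integral f)"

end

theory Submission
  imports Defs
begin

text \<open>
  Write \<open>F\<close> for \<^const>\<open>recip_integral\<close> \<open>f\<close> and \<open>y\<close> for its inverse, so that \<open>y\<close> solves the unperturbed
  equation \<open>y' = - f y\<close> and \<open>F (y t) = t\<close>. Along a positive solution of the perturbed equation
  \<open>w' = - g (w + \<delta>)\<close> with \<open>g\<close> asymptotic to \<open>f\<close> at \<open>0+\<close>, the function \<open>F w\<close> has slope
  \<open>g (w + \<delta>) / f w\<close>. This slope is close to 1 wherever \<open>w\<close> is small and \<open>\<delta>\<close> is small relative to \<open>w\<close>.
  That is a statement about \<open>f\<close> at nearby points, for which pointwise convergence of
  \<open>f (c u) / f u\<close> is too weak; local uniformity (\<open>regularly_varying_uniform_near_1\<close>) is needed, and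
  for continuous \<open>f\<close> it follows from Baire's theorem.

  Since \<open>F\<close> is regularly varying with the index \<open>1 - \<beta> < 0\<close> (L'Hopital, \<open>F_ratio\<close>), comparing \<open>w\<close> with
  multiples of \<open>y\<close> amounts to comparing \<open>F w\<close> with multiples of \<open>t\<close>. Suppose \<open>w \<ge> \<eta> y\<close> holds at
  arbitrarily late times, and choose such a time late enough. There \<open>F w \<le> C t\<close>, and as long as
  \<open>F w \<le> 2 C t\<close> the solution stays above a fixed multiple of \<open>y\<close>, so that \<open>\<delta>\<close> is negligible
  against it and the slope of \<open>F w\<close> is at most \<open>3 / 2 < 2 C\<close>. Hence \<open>F w\<close> never reaches the line
  \<open>2 C t\<close> (\<open>solution_stays_above_barrier\<close>). Then \<open>\<delta> / w\<close> tends to 0, the slope tends to 1, so \<open>F w\<close> is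
  asymptotic to \<open>t\<close>, and therefore \<open>w\<close> to \<open>y\<close> (\<open>exact_rate_if_frequently_comparable\<close>).

  If \<open>\<bar>x\<bar> / y\<close> does not tend to 0, then \<open>x\<close> or \<open>- x\<close> is frequently at least some \<open>\<eta> y\<close>, and the
  preceding result applies to it: \<open>- x\<close> solves an equation of the same form with
  \<open>g u = - f (- u)\<close>, which is asymptotic to \<open>f\<close> because \<open>f\<close> is asymptotically odd.
\<close>

section \<open>Local uniformity in regular variation\<close>

lemma some_closed_set_of_countable_cover_contains_ball:
  fixes E :: "nat \<Rightarrow> 'a::euclidean_space set"
  assumes closed: "\<And>n. closed (E n)" and cover: "(\<Union>n. E n) = UNIV"
  obtains n a r where "r > 0" "ball a r \<subseteq> E n"
proof -
  have "\<exists>n. interior (E n) \<noteq> {}"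
  proof (rule ccontr)
    assume empty: "\<not> (\<exists>n. interior (E n) \<noteq> {})"
    have "UNIV \<subseteq> closure (\<Inter> (range (\<lambda>n. - E n)))"
      by (rule Baire) (use closed empty in \<open>auto simp: closure_complement\<close>)
    moreover have "\<Inter> (range (\<lambda>n. - E n)) = {}"
      using cover by auto
    ultimately show False
      by simp
  qed
  then obtain n a where "a \<in> interior (E n)"
    by blast
  then show thesis
    using that by (auto simp: mem_interior)
qed

text \<open>
  The part of the uniform convergence theorem for regularly varying functions that concerns
  multipliers close to 1. In logarithmic coordinates \<open>k s = ln (f (exp s))\<close> the hypothesis says
  that \<open>k (s + u) - k s - \<beta> u\<close> tends to 0 as \<open>s\<close> tends to \<open>-\<infinity>\<close>, for each \<open>u\<close>. The shifts \<open>u\<close> for which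
  this quantity is at most \<open>e\<close> for all \<open>s \<le> - n\<close> form a closed set, so by Baire for some \<open>n\<close> they fill
  a ball around some \<open>a\<close>. Subtracting the estimates for \<open>a + u\<close> and \<open>a\<close> moves the ball to 0.
\<close>

lemma regularly_varying_uniform_near_1:
  fixes f :: "real \<Rightarrow> real"
  assumes cont: "continuous_on {0<..} f"
    and pos: "\<And>x. x > 0 \<Longrightarrow> f x > 0"
    and lim: "\<And>c. c > 0 \<Longrightarrow> ((\<lambda>x. f (c * x) / f x) \<longlongrightarrow> c powr \<beta>) (at_right 0)"
    and "\<epsilon> > 0"
  obtains d s where "d > 0" "s > 0"
    "\<And>v w. 0 < v \<Longrightarrow> v < s \<Longrightarrow> \<bar>w - v\<bar> \<le> d * v \<Longrightarrow> \<bar>f w / f v - 1\<bar> \<le> \<epsilon>"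
proof -
  define k where "k s = ln (f (exp s))" for s
  define e where "e = ln (1 + \<epsilon>) / 3"
  have "e > 0"
    using \<open>\<epsilon> > 0\<close> by (simp add: e_def)
  have k_cont: "continuous_on UNIV k"
    unfolding k_def
    by (intro continuous_intros continuous_on_compose2[OF cont]) (auto simp: less_imp_neq[OF pos, symmetric])
  define E where "E n = (\<Inter>s\<in>{..- real n}. {u. \<bar>k (s + u) - k s - \<beta> * u\<bar> \<le> e})" for n
  have "closed (E n)" for n
    unfolding E_def
    by (intro closed_INT ballI closed_Collect_le continuous_intros continuous_on_compose2[OF k_cont]) auto
  moreover have "(\<Union>n. E n) = UNIV"
  proof (intro set_eqI iffI UNIV_I)
    fix u :: real
    have "((\<lambda>x. ln (f (exp u * x) / f x)) \<longlongrightarrow> ln (exp u powr \<beta>)) (at_right 0)"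
      by (intro tendsto_ln lim) auto
    then have "\<forall>\<^sub>F x in at_right 0. \<bar>ln (f (exp u * x) / f x) - \<beta> * u\<bar> < e"
      using \<open>e > 0\<close> by (auto simp: tendsto_iff dist_real_def ln_powr)
    then obtain b where "b > 0" and b: "\<And>x. 0 < x \<Longrightarrow> x < b \<Longrightarrow> \<bar>ln (f (exp u * x) / f x) - \<beta> * u\<bar> < e"
      by (auto simp: eventually_at_right_field)
    obtain n :: nat where n: "- ln b < n"
      using reals_Archimedean2 by blast
    have "\<bar>k (s + u) - k s - \<beta> * u\<bar> \<le> e" if "s \<le> - real n" for s
    proof -
      have "s < ln b"
        using n that by simp
      then have "exp s < b"
        using \<open>b > 0\<close> by (metis exp_less_cancel_iff exp_ln)
      then show ?thesis
        using b[of "exp s"] by (simp add: k_def exp_add ln_div pos mult.commute less_imp_neq[OF pos, symmetric])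
    qed
    then show "u \<in> (\<Union>n. E n)"
      by (auto simp: E_def)
  qed
  ultimately obtain n a r where "r > 0" and ball: "ball a r \<subseteq> E n"
    by (rule some_closed_set_of_countable_cover_contains_ball)
  \<comment> \<open>The second bound on the shift makes the drift term \<open>\<beta> u\<close> at most \<open>e\<close>; the added 1 covers \<open>\<beta> = 0\<close>.\<close>
  define h where "h = min (r / 2) (e / (\<bar>\<beta>\<bar> + 1))"
  have "h > 0"
    using \<open>r > 0\<close> \<open>e > 0\<close> by (simp add: h_def)
  have k_near: "\<bar>k (s + u) - k s\<bar> \<le> 3 * e" if "s \<le> a - n" "\<bar>u\<bar> \<le> h" for s u
  proof -
    have "a \<in> E n" "a + u \<in> E n"
      using ball that \<open>r > 0\<close> by (auto simp: h_def dist_real_def subset_iff)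
    then have "\<bar>k (s - a + a) - k (s - a) - \<beta> * a\<bar> \<le> e"
      "\<bar>k (s - a + (a + u)) - k (s - a) - \<beta> * (a + u)\<bar> \<le> e"
      unfolding E_def using that(1) by (simp_all only: INT_iff mem_Collect_eq atMost_iff)
    moreover have "\<bar>\<beta> * u\<bar> \<le> e"
    proof -
      have "\<bar>\<beta> * u\<bar> \<le> (\<bar>\<beta>\<bar> + 1) * (e / (\<bar>\<beta>\<bar> + 1))"
        unfolding abs_mult by (intro mult_mono) (use that in \<open>auto simp: h_def\<close>)
      then show ?thesis
        by simp
    qed
    ultimately show ?thesis
      by (auto simp: algebra_simps abs_le_iff)
  qed
  show thesis
  proof (rule that)
    \<comment> \<open>The interval of radius \<open>1 - exp (- h)\<close> around 1 is contained in \<open>{exp (- h)..exp h}\<close>.\<close>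
    show "1 - exp (- h) > 0" "exp (a - n) > 0"
      using \<open>h > 0\<close> by auto
    fix v w :: real
    assume v: "0 < v" "v < exp (a - n)" and w: "\<bar>w - v\<bar> \<le> (1 - exp (- h)) * v"
    have "1 + h \<le> exp h" "1 + - h \<le> exp (- h)"
      by (rule exp_ge_add_one_self)+
    then have "2 - exp (- h) \<le> exp h"
      by linarith
    then have "(2 - exp (- h)) * v \<le> exp h * v"
      using v by (intro mult_right_mono) auto
    then have w_bounds: "exp (- h) * v \<le> w" "w \<le> exp h * v"
      using w by (auto simp: abs_le_iff algebra_simps)
    have "w > 0"
      using w_bounds(1) v by (smt (verit) exp_gt_zero mult_pos_pos)
    have "ln (exp (- h) * v) \<le> ln w" "ln w \<le> ln (exp h * v)"
      using w_bounds v \<open>w > 0\<close> by (subst ln_le_cancel_iff; simp)+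
    then have "\<bar>ln w - ln v\<bar> \<le> h"
      using v by (auto simp: ln_mult)
    moreover have "ln v \<le> a - n"
      using v by (metis exp_gt_zero less_imp_le ln_exp ln_le_cancel_iff)
    ultimately have "\<bar>k (ln v + (ln w - ln v)) - k (ln v)\<bar> \<le> 3 * e"
      by (intro k_near)
    then have ln_bound: "\<bar>ln (f w / f v)\<bar> \<le> ln (1 + \<epsilon>)"
      using v \<open>w > 0\<close> by (simp add: k_def e_def ln_div pos less_imp_neq[OF pos, symmetric])
    define q where "q = f w / f v"
    have "q > 0"
      using pos v \<open>w > 0\<close> by (simp add: q_def)
    have "ln q \<le> ln (1 + \<epsilon>)" "ln (inverse (1 + \<epsilon>)) \<le> ln q"
      using ln_bound \<open>\<epsilon> > 0\<close> by (auto simp: q_def ln_inverse)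
    then have "q \<le> 1 + \<epsilon>" "inverse (1 + \<epsilon>) \<le> q"
      using \<open>q > 0\<close> \<open>\<epsilon> > 0\<close> by (auto simp: ln_le_cancel_iff)
    moreover have "1 - \<epsilon> \<le> inverse (1 + \<epsilon>)"
      using \<open>\<epsilon> > 0\<close> by (simp add: field_simps)
    ultimately show "\<bar>f w / f v - 1\<bar> \<le> \<epsilon>"
      unfolding q_def[symmetric] by linarith
  qed
qed

section \<open>The unperturbed equation\<close>

locale regularly_varying_rate =
  fixes f :: "real \<Rightarrow> real" and \<beta> :: real
  assumes cont: "continuous_on {0<..} f"
    and pos: "\<And>u. u > 0 \<Longrightarrow> f u > 0"
    and ratio: "\<And>c. c > 0 \<Longrightarrow> ((\<lambda>u. f (c * u) / f u) \<longlongrightarrow> c powr \<beta>) (at_right 0)"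
    and index: "\<beta> > 1"
    and sublinear: "((\<lambda>u. f u / u) \<longlongrightarrow> 0) (at_right 0)"
begin

abbreviation F :: "real \<Rightarrow> real" where "F \<equiv> recip_integral f"
abbreviation y :: "real \<Rightarrow> real" where "y \<equiv> recip_integral_inv f"

lemma F_has_derivative:
  assumes "u > 0"
  shows "(F has_real_derivative - (1 / f u)) (at u)"
proof -
  \<comment> \<open>The interval \<open>{a..b}\<close> has to contain both \<open>u\<close> and the base point 1 of the integral in its interior.\<close>
  define a b where "a = min u 1 / 2" and "b = max u 1 + 1"
  have ab: "0 < a" "a < u" "u < b" "a < 1" "1 < b"
    using assms by (auto simp: a_def b_def)
  have "continuous_on {a..b} (\<lambda>u. 1 / f u)"
    by (intro continuous_intros continuous_on_subset[OF cont])
      (use ab in \<open>auto simp: less_imp_neq[OF pos, symmetric]\<close>)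
  then have "((\<lambda>v. LBINT u=1..v. 1 / f u) has_vector_derivative 1 / f u) (at u within {a..b})"
    using interval_integral_FTC2[of a 1 b "\<lambda>u. 1 / f u" u] ab by (simp add: one_ereal_def)
  moreover have "at u within {a..b} = at u"
    by (rule at_within_interior) (use ab in auto)
  ultimately have "((\<lambda>v. LBINT u=1..v. 1 / f u) has_real_derivative 1 / f u) (at u)"
    by (simp only: has_real_derivative_iff_has_vector_derivative)
  then have "((\<lambda>v. - (LBINT u=1..v. 1 / f u)) has_real_derivative - (1 / f u)) (at u)"
    by (rule DERIV_minus)
  moreover have "F = (\<lambda>v. - (LBINT u=1..v. 1 / f u))"
    unfolding recip_integral_def fun_eq_iff
    using interval_integral_endpoints_reverse by blast
  ultimately show ?thesis
    by simp
qed

lemma F_strict_antimono: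
  assumes "0 < u" "u < v"
  shows "F v < F u"
proof (rule DERIV_neg_imp_decreasing[OF \<open>u < v\<close>])
  fix r assume "u \<le> r" "r \<le> v"
  then have "r > 0"
    using assms by simp
  then show "\<exists>d. (F has_real_derivative d) (at r) \<and> d < 0"
    using F_has_derivative[of r] pos[of r] by (intro exI[of _ "- (1 / f r)"]) simp
qed

lemma F_antimono: "0 < u \<Longrightarrow> u \<le> v \<Longrightarrow> F v \<le> F u"
  using F_strict_antimono[of u v] by (cases "u = v") auto

lemma F_less_iff: "0 < u \<Longrightarrow> 0 < v \<Longrightarrow> F u < F v \<longleftrightarrow> v < u"
  by (meson F_antimono F_strict_antimono not_le)

lemma F_le_iff: "0 < u \<Longrightarrow> 0 < v \<Longrightarrow> F u \<le> F v \<longleftrightarrow> v \<le> u"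
  by (meson F_less_iff not_le)

lemma inj_on_F: "inj_on F {0<..}"
  by (rule linorder_inj_onI) (auto dest: F_strict_antimono)

lemma F_1: "F 1 = 0"
  by (simp add: recip_integral_def one_ereal_def)

text \<open>Near 0 the sublinearity of \<open>f\<close> gives \<open>1 / f u \<ge> 1 / u\<close>, so \<open>F\<close> grows at least as fast as \<open>- ln u\<close>.\<close>

lemma F_at_top: "filterlim F at_top (at_right 0)"
proof -
  have "\<forall>\<^sub>F u in at_right 0. f u / u < 1"
    using order_tendstoD(2)[OF sublinear] by simp
  then obtain b where "b > 0" and b: "\<And>u. 0 < u \<Longrightarrow> u < b \<Longrightarrow> f u / u < 1"
    by (auto simp: eventually_at_right_field)
  define c where "c = b / 2"
  have "c > 0" and c: "\<And>u. 0 < u \<Longrightarrow> u \<le> c \<Longrightarrow> f u \<le> u"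
    using \<open>b > 0\<close> b by (auto simp: c_def field_simps less_imp_le)
  have lower: "F c + (ln c - ln u) \<le> F u" if "0 < u" "u < c" for u
  proof -
    have "F c + ln c \<le> F u + ln u"
    proof (rule DERIV_nonpos_imp_nonincreasing[of u c "\<lambda>u. F u + ln u"])
      fix v assume "u \<le> v" "v \<le> c"
      then have "v > 0" "f v \<le> v" "f v > 0"
        using that c pos by auto
      then show "\<exists>d. ((\<lambda>u. F u + ln u) has_real_derivative d) (at v) \<and> d \<le> 0"
        by (intro exI[of _ "- (1 / f v) + 1 / v"] conjI DERIV_add F_has_derivative DERIV_ln_divide)
          (auto simp: field_simps)
    qed (use that in auto)
    then show ?thesis
      by simp
  qed
  have "filterlim (\<lambda>u. (F c + ln c) + - ln u) at_top (at_right 0)"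
    by (intro filterlim_tendsto_add_at_top[OF tendsto_const] filterlim_compose[OF filterlim_uminus_at_top_at_bot] ln_at_0)
  then show ?thesis
    by (rule filterlim_at_top_mono)
      (use lower \<open>c > 0\<close> in \<open>auto simp: eventually_at_right_field algebra_simps intro!: exI[of _ c]\<close>)
qed

text \<open>
  L'Hopital's rule turns the quotient of integrals into \<open>c * f u / f (c * u)\<close>, whose limit is given
  by regular variation.
\<close>

lemma F_ratio:
  assumes "c > 0"
  shows "((\<lambda>u. F (c * u) / F u) \<longlongrightarrow> c powr (1 - \<beta>)) (at_right 0)"
proof (rule lhopital_right_0_at_top[OF F_at_top])
  show "\<forall>\<^sub>F u in at_right 0. - (1 / f u) \<noteq> 0"
    by (auto simp: eventually_at_right_field less_imp_neq[OF pos, symmetric] intro!: exI[of _ 1])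
  show "\<forall>\<^sub>F u in at_right 0. ((\<lambda>u. F (c * u)) has_real_derivative - (1 / f (c * u)) * c) (at u)"
    unfolding eventually_at_right_field
  proof (intro exI[of _ 1] conjI allI impI)
    fix u :: real assume "0 < u"
    then have "(F has_real_derivative - (1 / f (c * u))) (at (c * u))"
      using assms by (intro F_has_derivative) simp
    then show "((\<lambda>u. F (c * u)) has_real_derivative - (1 / f (c * u)) * c) (at u)"
      by (rule DERIV_chain2) (auto intro!: derivative_eq_intros)
  qed simp
  show "\<forall>\<^sub>F u in at_right 0. (F has_real_derivative - (1 / f u)) (at u)"
    by (auto simp: eventually_at_right_field intro!: exI[of _ 1] F_has_derivative)
  have "((\<lambda>u. c / (f (c * u) / f u)) \<longlongrightarrow> c / c powr \<beta>) (at_right 0)"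
    using assms by (intro tendsto_intros ratio) auto
  moreover have "c / c powr \<beta> = c powr (1 - \<beta>)"
    using assms by (simp add: powr_diff)
  moreover have "c / (f (c * u) / f u) = - (1 / f (c * u)) * c / - (1 / f u)" for u
    by simp
  ultimately show "((\<lambda>u. - (1 / f (c * u)) * c / - (1 / f u)) \<longlongrightarrow> c powr (1 - \<beta>)) (at_right 0)"
    by simp
qed

lemma y_F: "u > 0 \<Longrightarrow> y (F u) = u"
  by (simp add: recip_integral_inv_def inv_into_f_f[OF inj_on_F])

lemma nonneg_in_range_F:
  assumes "t \<ge> 0"
  shows "t \<in> F ` {0<..}"
proof -
  have "\<forall>\<^sub>F u in at_right 0. t \<le> F u"
    using F_at_top by (simp add: filterlim_at_top)
  then obtain b where "b > 0" and b: "\<And>u. 0 < u \<Longrightarrow> u < b \<Longrightarrow> t \<le> F u"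
    by (auto simp: eventually_at_right_field)
  define a where "a = min b 1 / 2"
  have a: "0 < a" "a \<le> 1" "t \<le> F a"
    using \<open>b > 0\<close> b[of a] by (auto simp: a_def)
  have "\<exists>u\<ge>a. u \<le> 1 \<and> F u = t"
    by (rule IVT2) (use a assms in \<open>auto simp: F_1 intro!: DERIV_isCont[OF F_has_derivative]\<close>)
  then show ?thesis
    using a by fastforce
qed

lemma y_pos: "t \<ge> 0 \<Longrightarrow> y t > 0"
  and F_y: "t \<ge> 0 \<Longrightarrow> F (y t) = t"
  using inv_into_into[OF nonneg_in_range_F] f_inv_into_f[OF nonneg_in_range_F]
  by (auto simp: recip_integral_inv_def)

lemma le_y_iff: "0 < u \<Longrightarrow> 0 \<le> t \<Longrightarrow> u \<le> y t \<longleftrightarrow> t \<le> F u"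
  using F_le_iff[of "y t" u] by (simp add: y_pos F_y)

lemma isCont_y:
  assumes "t \<ge> 0"
  shows "isCont y t"
proof -
  have "isCont y (F (y t))"
    by (rule isCont_inverse_function2[where a = "y t / 2" and b = "y t + 1"])
      (use y_pos[OF assms] in \<open>auto simp: y_F intro!: DERIV_isCont[OF F_has_derivative]\<close>)
  then show ?thesis
    by (simp add: F_y assms)
qed

lemma y_tendsto_0: "filterlim y (at_right 0) at_top"
  unfolding filterlim_at
proof
  show "\<forall>\<^sub>F t in at_top. y t \<in> {0<..} \<and> y t \<noteq> 0"
    using eventually_ge_at_top[of 0] by eventually_elim (auto dest: y_pos)
  show "(y \<longlongrightarrow> 0) at_top"
  proof (rule tendstoI)
    fix e :: real assume "e > 0"
    show "\<forall>\<^sub>F t in at_top. dist (y t) 0 < e"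
      using eventually_ge_at_top[of 0] eventually_gt_at_top[of "F e"]
    proof eventually_elim
      case (elim t)
      then show ?case
        using le_y_iff[of e t] y_pos[of t] \<open>e > 0\<close> by (auto simp: dist_real_def)
    qed
  qed
qed

lemma F_multiple_of_y:
  assumes "c > 0"
  shows "((\<lambda>t. F (c * y t) / t) \<longlongrightarrow> c powr (1 - \<beta>)) at_top"
proof (rule Lim_transform_eventually)
  show "((\<lambda>t. F (c * y t) / F (y t)) \<longlongrightarrow> c powr (1 - \<beta>)) at_top"
    using filterlim_compose[OF F_ratio[OF assms] y_tendsto_0] .
  show "\<forall>\<^sub>F t in at_top. F (c * y t) / F (y t) = F (c * y t) / t"
    using eventually_ge_at_top[of 0] by eventually_elim (simp add: F_y)
qed

text \<open>
  An asymptotic equivalence can be inverted here because \<open>F\<close> is monotone and its index \<open>1 - \<beta>\<close> is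
  nonzero: for positive \<open>c \<noteq> 1\<close> the limit \<open>c powr (1 - \<beta>)\<close> of \<open>F (c * y t) / t\<close> lies strictly on one side of 1,
  so \<open>w t\<close> is eventually on the corresponding side of \<open>c * y t\<close>.
\<close>

lemma equivalent_of_F_equivalent:
  assumes w_pos: "\<forall>\<^sub>F t in at_top. w t > 0"
    and Fw: "((\<lambda>t. F (w t) / t) \<longlongrightarrow> 1) at_top"
  shows "((\<lambda>t. w t / y t) \<longlongrightarrow> 1) at_top"
proof (rule order_tendstoI)
  fix c :: real
  assume c: "c < 1"
  show "\<forall>\<^sub>F t in at_top. c < w t / y t"
  proof (cases "c > 0")
    case True
    have "1 powr (1 - \<beta>) < c powr (1 - \<beta>)"
      by (rule powr_less_mono2_neg) (use index c True in auto)
    then obtain m where m: "1 < m" "m < c powr (1 - \<beta>)"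
      using dense by auto
    show ?thesis
      using w_pos order_tendstoD(2)[OF Fw m(1)] order_tendstoD(1)[OF F_multiple_of_y[OF True] m(2)]
        eventually_gt_at_top[of 0]
    proof eventually_elim
      case (elim t)
      then have "F (w t) / t < F (c * y t) / t"
        by linarith
      then have "F (w t) < F (c * y t)"
        using elim by (simp add: divide_less_cancel)
      then show ?case
        using elim True y_pos[of t] by (simp add: F_less_iff field_simps)
    qed
  next
    case False
    show ?thesis
      using w_pos eventually_gt_at_top[of 0]
    proof eventually_elim
      case (elim t)
      then have "0 < w t / y t"
        using y_pos[of t] by simp
      then show ?case
        using False by linarith
    qed
  qed
next
  fix c :: real
  assume c: "1 < c"
  have "c powr (1 - \<beta>) < 1 powr (1 - \<beta>)"
    by (rule powr_less_mono2_neg) (use index c in auto)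
  then obtain m where m: "m < 1" "c powr (1 - \<beta>) < m"
    using dense by auto
  have "c > 0"
    using c by simp
  show "\<forall>\<^sub>F t in at_top. w t / y t < c"
    using w_pos order_tendstoD(1)[OF Fw m(1)] order_tendstoD(2)[OF F_multiple_of_y[OF \<open>c > 0\<close>] m(2)]
      eventually_gt_at_top[of 0]
  proof eventually_elim
    case (elim t)
    then have "F (c * y t) / t < F (w t) / t"
      using c by linarith
    then have "F (c * y t) < F (w t)"
      using elim by (simp add: divide_less_cancel)
    then show ?case
      using elim c y_pos[of t] by (simp add: F_less_iff field_simps)
  qed
qed

section \<open>The perturbed equation\<close>

text \<open>
  Local uniformity replaces \<open>v\<close> by \<open>v + p\<close> inside \<open>f\<close>, and the equivalence of \<open>g\<close> and \<open>f\<close> is then used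
  at \<open>v + p\<close>. The bound \<open>1 / 2\<close> on the relative perturbation keeps \<open>v + p\<close> positive.
\<close>

lemma perturbed_ratio_near_1:
  fixes g :: "real \<Rightarrow> real"
  assumes g: "((\<lambda>u. g u / f u) \<longlongrightarrow> 1) (at_right 0)" and "\<epsilon> > 0"
  obtains d s where "d > 0" "s > 0"
    "\<And>v p. 0 < v \<Longrightarrow> v < s \<Longrightarrow> \<bar>p\<bar> \<le> d * v \<Longrightarrow> \<bar>g (v + p) / f v - 1\<bar> \<le> \<epsilon>"
proof -
  define e where "e = min (\<epsilon> / 3) 1"
  have e: "0 < e" "e \<le> 1" "3 * e \<le> \<epsilon>"
    using \<open>\<epsilon> > 0\<close> by (auto simp: e_def)
  obtain d s where "d > 0" "s > 0"
    and f_near: "\<And>v w. 0 < v \<Longrightarrow> v < s \<Longrightarrow> \<bar>w - v\<bar> \<le> d * v \<Longrightarrow> \<bar>f w / f v - 1\<bar> \<le> e"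
    using regularly_varying_uniform_near_1[OF cont pos ratio \<open>0 < e\<close>] by metis
  have "\<forall>\<^sub>F u in at_right 0. \<bar>g u / f u - 1\<bar> < e"
    using g \<open>0 < e\<close> by (simp add: tendsto_iff dist_real_def)
  then obtain b where "b > 0" and g_near: "\<And>u. 0 < u \<Longrightarrow> u < b \<Longrightarrow> \<bar>g u / f u - 1\<bar> < e"
    by (auto simp: eventually_at_right_field)
  show thesis
  proof (rule that)
    show "min d (1 / 2) > 0" "min s (b / 2) > 0"
      using \<open>d > 0\<close> \<open>s > 0\<close> \<open>b > 0\<close> by auto
    fix v p :: real
    assume v: "0 < v" "v < min s (b / 2)" and p: "\<bar>p\<bar> \<le> min d (1 / 2) * v"
    have "min d (1 / 2) * v \<le> d * v" "min d (1 / 2) * v \<le> 1 / 2 * v"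
      using v by (intro mult_right_mono; simp)+
    then have p': "\<bar>p\<bar> \<le> d * v" "\<bar>p\<bar> \<le> v / 2"
      using p by linarith+
    define A B where "A = g (v + p) / f (v + p)" and "B = f (v + p) / f v"
    have A: "\<bar>A - 1\<bar> \<le> e"
      unfolding A_def using v p' by (intro less_imp_le g_near) auto
    have B: "\<bar>B - 1\<bar> \<le> e"
      unfolding B_def using v p' by (intro f_near) auto
    have "\<bar>(A - 1) * (B - 1)\<bar> \<le> e * 1"
      unfolding abs_mult by (intro mult_mono) (use A B e in auto)
    moreover have "A * B - 1 = (A - 1) * (B - 1) + (A - 1) + (B - 1)"
      by (simp add: algebra_simps)
    ultimately have "\<bar>A * B - 1\<bar> \<le> 3 * e"
      using A B by linarith
    moreover have "f (v + p) > 0"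
      using v p' by (intro pos) linarith
    then have "A * B = g (v + p) / f v"
      by (simp add: A_def B_def)
    ultimately show "\<bar>g (v + p) / f v - 1\<bar> \<le> \<epsilon>"
      using e by simp
  qed
qed

lemma perturbed_ratio_tendsto_1:
  assumes g: "((\<lambda>u. g u / f u) \<longlongrightarrow> 1) (at_right 0)"
    and w_pos: "\<forall>\<^sub>F t in T. w t > 0" and w_lim: "(w \<longlongrightarrow> 0) T"
    and \<delta>: "((\<lambda>t. \<delta> t / w t) \<longlongrightarrow> 0) T"
  shows "((\<lambda>t. g (w t + \<delta> t) / f (w t)) \<longlongrightarrow> 1) T"
proof (rule tendstoI)
  fix \<epsilon> :: real assume "\<epsilon> > 0"
  then have "\<epsilon> / 2 > 0"
    by simp
  from perturbed_ratio_near_1[OF g this] obtain d s where "d > 0" "s > 0"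
    and near: "\<And>v p. 0 < v \<Longrightarrow> v < s \<Longrightarrow> \<bar>p\<bar> \<le> d * v \<Longrightarrow> \<bar>g (v + p) / f v - 1\<bar> \<le> \<epsilon> / 2"
    by blast
  have "\<forall>\<^sub>F t in T. \<bar>\<delta> t / w t\<bar> < d"
    using \<delta> \<open>d > 0\<close> by (simp add: tendsto_iff)
  with w_pos order_tendstoD(2)[OF w_lim \<open>s > 0\<close>]
  show "\<forall>\<^sub>F t in T. dist (g (w t + \<delta> t) / f (w t)) 1 < \<epsilon>"
  proof eventually_elim
    case (elim t)
    then have "\<bar>\<delta> t\<bar> \<le> d * w t"
      by (simp add: abs_divide field_simps)
    with elim near[of "w t" "\<delta> t"] \<open>\<epsilon> > 0\<close> show ?case
      by (simp add: dist_real_def)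
  qed
qed

lemma F_along_solution_has_derivative:
  assumes "(w has_real_derivative - r) (at t)" and "w t > 0"
  shows "((\<lambda>t. F (w t)) has_real_derivative r / f (w t)) (at t)"
  using DERIV_chain2[OF F_has_derivative[OF assms(2)] assms(1)] by simp

text \<open>
  The curve \<open>y (2 * C * t)\<close> is where \<open>F w\<close> would equal \<open>2 * C * t\<close>. The solution starts with
  \<open>F w \<le> C * t\<close>, strictly above this barrier. Up to the first time \<open>t1\<close> at which it touches the barrier, \<open>F w\<close>
  grows at rate at most \<open>3 / 2\<close>, so \<open>F (w t1) \<le> C * t0 + 3 / 2 * (t1 - t0) < 2 * C * t1\<close>, a
  contradiction. The barrier is a positive curve, so it is met before \<open>w\<close> could reach 0, where \<open>F w\<close>
  would cease to describe the solution.
\<close>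

lemma solution_stays_above_barrier:
  assumes deriv: "\<And>t. t > 0 \<Longrightarrow> (w has_real_derivative - r t) (at t)"
    and slope: "\<And>t. t \<ge> t0 \<Longrightarrow> w t \<ge> y (2 * C * t) \<Longrightarrow> r t / f (w t) \<le> 3 / 2"
    and "t0 > 0" and "C > 1" and "w t0 > 0" and start: "F (w t0) \<le> C * t0"
    and "t \<ge> t0"
  shows "w t > y (2 * C * t)"
proof (rule ccontr)
  assume "\<not> w t > y (2 * C * t)"
  define S where "S = {\<tau> \<in> {t0..t}. w \<tau> \<le> y (2 * C * \<tau>)}"
  have w_cont: "continuous_on {t0..t} w"
    using \<open>t0 > 0\<close> by (intro continuous_at_imp_continuous_on ballI DERIV_isCont[OF deriv]) auto
  have "continuous_on {0..} y"
    by (intro continuous_at_imp_continuous_on ballI isCont_y) simp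
  then have y_cont: "continuous_on {t0..t} (\<lambda>\<tau>. y (2 * C * \<tau>))"
    by (rule continuous_on_compose2)
      (use \<open>t0 > 0\<close> \<open>C > 1\<close> in \<open>auto intro!: continuous_on_mult_left continuous_on_id\<close>)
  have "closed S"
    unfolding S_def by (intro continuous_on_closed_Collect_le w_cont y_cont) simp
  moreover have "t \<in> S"
    using \<open>\<not> w t > y (2 * C * t)\<close> \<open>t \<ge> t0\<close> by (simp add: S_def)
  moreover have bdd: "bdd_below S"
    by (rule bdd_belowI[of _ t0]) (simp add: S_def)
  ultimately have "Inf S \<in> S"
    by (intro closed_contains_Inf) auto
  define t1 where "t1 = Inf S"
  have t1: "t0 \<le> t1" "t1 \<le> t" "w t1 \<le> y (2 * C * t1)"
    using \<open>Inf S \<in> S\<close> by (auto simp: S_def t1_def)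
  have "F (w t0) < 2 * C * t0"
    using start mult_strict_right_mono[of C "2 * C" t0, OF _ \<open>t0 > 0\<close>] \<open>C > 1\<close> by linarith
  then have above_start: "y (2 * C * t0) < w t0"
    using le_y_iff[of "w t0" "2 * C * t0"] \<open>w t0 > 0\<close> \<open>t0 > 0\<close> \<open>C > 1\<close> by simp
  have "\<exists>\<tau>\<ge>t0. \<tau> \<le> t1 \<and> w \<tau> - y (2 * C * \<tau>) = 0"
  proof (rule IVT2')
    show "continuous_on {t0..t1} (\<lambda>\<tau>. w \<tau> - y (2 * C * \<tau>))"
      by (rule continuous_on_subset[of "{t0..t}"], intro continuous_on_diff w_cont y_cont)
        (use t1 in auto)
  qed (use t1 above_start in auto)
  then obtain \<tau> where \<tau>: "t0 \<le> \<tau>" "\<tau> \<le> t1" "w \<tau> = y (2 * C * \<tau>)"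
    by auto
  then have "\<tau> \<in> S"
    using t1 by (simp add: S_def)
  then have "\<tau> = t1"
    using \<tau> cInf_lower[OF _ bdd] by (force simp: t1_def)
  then have touch: "w t1 = y (2 * C * t1)"
    using \<tau> by simp
  have above: "w \<sigma> \<ge> y (2 * C * \<sigma>)" if "t0 \<le> \<sigma>" "\<sigma> \<le> t1" for \<sigma>
  proof (rule ccontr)
    assume "\<not> w \<sigma> \<ge> y (2 * C * \<sigma>)"
    then have "\<sigma> \<in> S"
      using that t1 by (simp add: S_def)
    then have "\<sigma> = t1"
      using that cInf_lower[OF _ bdd] by (force simp: t1_def)
    with touch \<open>\<not> w \<sigma> \<ge> y (2 * C * \<sigma>)\<close> show False
      by simp
  qed
  have "F (w t1) - 3 / 2 * t1 \<le> F (w t0) - 3 / 2 * t0"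
  proof (rule DERIV_nonpos_imp_nonincreasing[of t0 t1 "\<lambda>\<tau>. F (w \<tau>) - 3 / 2 * \<tau>"])
    fix \<sigma> assume \<sigma>: "t0 \<le> \<sigma>" "\<sigma> \<le> t1"
    then have "\<sigma> > 0"
      using \<open>t0 > 0\<close> by simp
    then have "w \<sigma> > 0"
      using above[OF \<sigma>] y_pos[of "2 * C * \<sigma>"] \<open>C > 1\<close> by simp
    have "((\<lambda>\<tau>. F (w \<tau>) - 3 / 2 * \<tau>) has_real_derivative r \<sigma> / f (w \<sigma>) - 3 / 2) (at \<sigma>)"
      by (rule derivative_eq_intros F_along_solution_has_derivative deriv \<open>\<sigma> > 0\<close> \<open>w \<sigma> > 0\<close> refl | simp)+
    then show "\<exists>d. ((\<lambda>\<tau>. F (w \<tau>) - 3 / 2 * \<tau>) has_real_derivative d) (at \<sigma>) \<and> d \<le> 0"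
      using slope[OF \<sigma>(1) above[OF \<sigma>]] by (intro exI conjI) auto
  qed (use t1 in auto)
  moreover have "F (w t1) = 2 * C * t1"
    using touch F_y[of "2 * C * t1"] t1 \<open>t0 > 0\<close> \<open>C > 1\<close> by simp
  moreover have "1 * (t1 - t0) \<le> C * (t1 - t0)" "1 * t1 < C * t1"
    using t1 \<open>t0 > 0\<close> \<open>C > 1\<close> by (intro mult_right_mono mult_strict_right_mono; simp)+
  ultimately show False
    using start \<open>t0 > 0\<close> t1 by (simp add: right_diff_distrib)
qed

text \<open>
  A single late time at which \<open>w\<close> is comparable with \<open>y\<close> suffices: from there on the barrier keeps
  \<open>w\<close> above a multiple of \<open>y\<close>, against which \<open>\<delta>\<close> is negligible. Frequent comparability is
  assumed because how late the time must be depends on \<open>\<eta>\<close>.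
\<close>

lemma exact_rate_if_frequently_comparable:
  assumes g: "((\<lambda>u. g u / f u) \<longlongrightarrow> 1) (at_right 0)"
    and ode: "\<And>t. t > 0 \<Longrightarrow> (w has_real_derivative - g (w t + \<delta> t)) (at t)"
    and \<delta>: "((\<lambda>t. \<delta> t / y t) \<longlongrightarrow> 0) at_top"
    and w_lim: "(w \<longlongrightarrow> 0) at_top"
    and "\<eta> > 0" and freq: "\<exists>\<^sub>F t in at_top. \<eta> * y t \<le> w t"
  shows "((\<lambda>t. w t / y t) \<longlongrightarrow> 1) at_top"
proof -
  \<comment> \<open>The limit \<open>\<eta> powr (1 - \<beta>)\<close> of \<open>F (\<eta> * y t) / t\<close> is less than \<open>C\<close>, so \<open>\<eta> * y t \<le> w t\<close> gives \<open>F (w t) \<le> C * t\<close>.\<close>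
  define C where "C = max 1 (\<eta> powr (1 - \<beta>)) + 1"
  have C: "1 < C" "\<eta> powr (1 - \<beta>) < C"
    by (auto simp: C_def)
  \<comment> \<open>Chosen so that \<open>\<kappa> * y t\<close> lies below the barrier \<open>y (2 * C * t)\<close> for large \<open>t\<close>.\<close>
  define \<kappa> where "\<kappa> = (2 * C + 1) powr (1 / (1 - \<beta>))"
  have "\<kappa> > 0"
    using C by (simp add: \<kappa>_def)
  have "\<kappa> powr (1 - \<beta>) = 2 * C + 1"
    using C index by (simp add: \<kappa>_def powr_powr)
  then have \<kappa>: "2 * C < \<kappa> powr (1 - \<beta>)"
    by simp
  have "(0 :: real) < 1 / 2"
    by simp
  from perturbed_ratio_near_1[OF g this] obtain d s where "d > 0" "s > 0"
    and near: "\<And>v p. 0 < v \<Longrightarrow> v < s \<Longrightarrow> \<bar>p\<bar> \<le> d * v \<Longrightarrow> \<bar>g (v + p) / f v - 1\<bar> \<le> 1 / 2"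
    by blast
  have \<delta>_small: "\<forall>\<^sub>F t in at_top. \<bar>\<delta> t / y t\<bar> < d * \<kappa>"
    using \<delta> \<open>d > 0\<close> \<open>\<kappa> > 0\<close> by (simp add: tendsto_iff)
  have "\<forall>\<^sub>F t in at_top. t > 0 \<and> F (\<eta> * y t) \<le> C * t \<and> \<kappa> * y t \<le> y (2 * C * t)
      \<and> \<bar>\<delta> t\<bar> \<le> d * (\<kappa> * y t) \<and> w t < s"
    using eventually_gt_at_top[of 0] order_tendstoD(2)[OF F_multiple_of_y[OF \<open>\<eta> > 0\<close>] C(2)]
      order_tendstoD(1)[OF F_multiple_of_y[OF \<open>\<kappa> > 0\<close>] \<kappa>] \<delta>_small order_tendstoD(2)[OF w_lim \<open>s > 0\<close>]
  proof eventually_elim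
    case (elim t)
    then have "y t > 0"
      by (intro y_pos) simp
    then show ?case
      using elim C \<open>\<kappa> > 0\<close> by (simp add: le_y_iff abs_divide field_simps)
  qed
  then obtain T where T: "\<And>t. t \<ge> T \<Longrightarrow> t > 0 \<and> F (\<eta> * y t) \<le> C * t \<and> \<kappa> * y t \<le> y (2 * C * t)
      \<and> \<bar>\<delta> t\<bar> \<le> d * (\<kappa> * y t) \<and> w t < s"
    by (auto simp: eventually_at_top_linorder)
  obtain t0 where t0: "t0 \<ge> T" "\<eta> * y t0 \<le> w t0"
    using frequently_eventually_frequently[OF freq eventually_ge_at_top[of T]]
    by (auto dest: frequently_ex)
  have "t0 > 0"
    using T t0 by blast
  then have "0 < \<eta> * y t0"
    using \<open>\<eta> > 0\<close> y_pos[of t0] by simp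
  then have "w t0 > 0" and start: "F (w t0) \<le> C * t0"
    using t0 F_antimono[of "\<eta> * y t0" "w t0"] T[OF t0(1)] by auto
  have slope: "g (w t + \<delta> t) / f (w t) \<le> 3 / 2" if "t \<ge> t0" "w t \<ge> y (2 * C * t)" for t
  proof -
    have *: "t > 0" "\<kappa> * y t \<le> w t" "\<bar>\<delta> t\<bar> \<le> d * (\<kappa> * y t)" "w t < s"
      using T[of t] that t0 by auto
    then have "0 < w t"
      using \<open>\<kappa> > 0\<close> y_pos[of t] by (smt (verit) mult_pos_pos)
    moreover have "d * (\<kappa> * y t) \<le> d * w t"
      using * \<open>d > 0\<close> by (intro mult_left_mono) auto
    ultimately have "\<bar>g (w t + \<delta> t) / f (w t) - 1\<bar> \<le> 1 / 2"
      using * by (intro near) auto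
    then show ?thesis
      by linarith
  qed
  have w_lower: "\<kappa> * y t \<le> w t" "t > 0" if "t \<ge> t0" for t
    using solution_stays_above_barrier[OF ode slope \<open>t0 > 0\<close> C(1) \<open>w t0 > 0\<close> start that] T[of t] that t0
    by auto
  have w_pos: "w t > 0" if "t \<ge> t0" for t
    using w_lower[OF that] \<open>\<kappa> > 0\<close> y_pos[of t] by (smt (verit) mult_pos_pos)
  have ev_pos: "\<forall>\<^sub>F t in at_top. w t > 0"
    using eventually_ge_at_top[of t0] by eventually_elim (rule w_pos)
  have "((\<lambda>t. \<delta> t / w t) \<longlongrightarrow> 0) at_top"
  proof (rule Lim_null_comparison)
    have "((\<lambda>t. \<bar>\<delta> t / y t\<bar> / \<kappa>) \<longlongrightarrow> \<bar>0\<bar> / \<kappa>) at_top"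
      using \<open>\<kappa> > 0\<close> by (intro tendsto_intros \<delta>) auto
    then show "((\<lambda>t. \<bar>\<delta> t / y t\<bar> / \<kappa>) \<longlongrightarrow> 0) at_top"
      by simp
    show "\<forall>\<^sub>F t in at_top. norm (\<delta> t / w t) \<le> \<bar>\<delta> t / y t\<bar> / \<kappa>"
      using eventually_ge_at_top[of t0]
    proof eventually_elim
      case (elim t)
      have "0 < \<kappa> * y t"
        using w_lower[OF elim] \<open>\<kappa> > 0\<close> y_pos[of t] by simp
      then have "\<bar>\<delta> t\<bar> / w t \<le> \<bar>\<delta> t\<bar> / (\<kappa> * y t)"
        using w_lower[OF elim] by (intro divide_left_mono) auto
      then show ?case
        using w_pos[OF elim] w_lower[OF elim] y_pos[of t] by (simp add: abs_divide mult.commute)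
    qed
  qed
  then have slope_lim: "((\<lambda>t. g (w t + \<delta> t) / f (w t)) \<longlongrightarrow> 1) at_top"
    by (rule perturbed_ratio_tendsto_1[OF g ev_pos w_lim])
  have "((\<lambda>t. F (w t) / t) \<longlongrightarrow> 1) at_top"
  proof (rule lhospital_at_top_at_top)
    show "\<forall>\<^sub>F t in at_top. ((\<lambda>t. F (w t)) has_real_derivative g (w t + \<delta> t) / f (w t)) (at t)"
      using eventually_ge_at_top[of t0]
      by eventually_elim (intro F_along_solution_has_derivative ode w_pos w_lower(2))
    show "\<forall>\<^sub>F t in at_top. ((\<lambda>t. t) has_real_derivative 1) (at t)"
      by simp
  qed (use slope_lim in \<open>auto simp: filterlim_ident\<close>)
  then show ?thesis
    by (rule equivalent_of_F_equivalent[OF ev_pos])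
qed

end

section \<open>The dichotomy\<close>

lemma odd_reflection_equivalent:
  fixes f \<phi> :: "real \<Rightarrow> real"
  assumes odd: "\<And>u. \<phi> (- u) = - \<phi> u"
    and lim: "((\<lambda>u. f u / \<phi> u) \<longlongrightarrow> 1) (at 0)"
  shows "((\<lambda>u. - f (- u) / f u) \<longlongrightarrow> 1) (at 0)"
proof (rule Lim_transform_eventually)
  have "filterlim uminus (at (0 :: real)) (at 0)"
    by (auto simp: filterlim_at eventually_at_filter intro!: tendsto_eq_intros)
  from filterlim_compose[OF lim this]
  have "((\<lambda>u. f (- u) / \<phi> (- u)) \<longlongrightarrow> 1) (at 0)" .
  from tendsto_divide[OF this lim]
  show "((\<lambda>u. f (- u) / \<phi> (- u) / (f u / \<phi> u)) \<longlongrightarrow> 1) (at 0)"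
    by simp
  have "\<forall>\<^sub>F u in at 0. f u / \<phi> u > 0"
    by (rule order_tendstoD(1)[OF lim]) simp
  then show "\<forall>\<^sub>F u in at 0. f (- u) / \<phi> (- u) / (f u / \<phi> u) = - f (- u) / f u"
    by eventually_elim (auto simp: odd zero_less_divide_iff)
qed

theorem theorem1:
  fixes f \<phi> \<gamma> x :: "real \<Rightarrow> real" and \<beta> \<xi> :: real
  assumes f_cont: "continuous_on UNIV f"
    and f_zero: "f 0 = 0"
    and f_sign: "\<And>u. u \<noteq> 0 \<Longrightarrow> u * f u > 0"
    and phi_odd: "\<And>u. \<phi> (- u) = - \<phi> u"
    and f_phi: "((\<lambda>u. f u / \<phi> u) \<longlongrightarrow> 1) (at 0)"
    and beta: "\<beta> > 1"
    and f_RV: "regularly_varying_at_0 f \<beta>"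
    and f_lin: "((\<lambda>u. f u / u) \<longlongrightarrow> 0) (at_right 0)"
    and gamma_cont: "continuous_on {0..} \<gamma>"
    and gamma_lim: "((\<lambda>t. \<gamma> t / recip_integral_inv f t) \<longlongrightarrow> 0) at_top"
    and x_cont: "continuous_on {0..} x"
    and x_ode: "\<And>t. t > 0 \<Longrightarrow> (x has_real_derivative - f (x t + \<gamma> t)) (at t)"
    and x_init: "x 0 = \<xi>"
    and x_lim: "(x \<longlongrightarrow> 0) at_top"
  shows "\<exists>L. ((\<lambda>t. \<bar>x t\<bar> / recip_integral_inv f t) \<longlongrightarrow> L) at_top \<and> (L = 0 \<or> L = 1)"
proof -
  have f_pos: "f u > 0" if "u > 0" for u
    using f_sign[of u] that by (simp add: zero_less_mult_iff)
  interpret regularly_varying_rate f \<beta>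
    using f_RV f_pos f_lin beta
    by unfold_locales (auto simp: regularly_varying_at_0_def intro: continuous_on_subset[OF f_cont])
  have upper: "((\<lambda>t. x t / y t) \<longlongrightarrow> 1) at_top"
    if "\<eta> > 0" "\<exists>\<^sub>F t in at_top. \<eta> * y t \<le> x t" for \<eta>
  proof (rule exact_rate_if_frequently_comparable[OF _ x_ode gamma_lim x_lim that])
    have "\<forall>\<^sub>F u in at_right 0. 1 = f u / f u"
      by (auto simp: eventually_at_right_field less_imp_neq[OF f_pos, symmetric] intro!: exI[of _ 1])
    then show "((\<lambda>u. f u / f u) \<longlongrightarrow> 1) (at_right 0)"
      by (rule Lim_transform_eventually[OF tendsto_const])
  qed
  have lower: "((\<lambda>t. - x t / y t) \<longlongrightarrow> 1) at_top"
    if "\<eta> > 0" "\<exists>\<^sub>F t in at_top. \<eta> * y t \<le> - x t" for \<eta>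
  proof (rule exact_rate_if_frequently_comparable[where g = "\<lambda>u. - f (- u)" and \<delta> = "\<lambda>t. - \<gamma> t", OF _ _ _ _ that])
    show "((\<lambda>u. - f (- u) / f u) \<longlongrightarrow> 1) (at_right 0)"
      using odd_reflection_equivalent[OF phi_odd f_phi] by (simp add: filterlim_at_split)
    show "((\<lambda>t. - x t) has_real_derivative - (- f (- (- x t + - \<gamma> t)))) (at t)" if "t > 0" for t
      using DERIV_minus[OF x_ode[OF that]] by (simp add: add.commute)
    show "((\<lambda>t. - \<gamma> t / y t) \<longlongrightarrow> 0) at_top"
      using tendsto_minus[OF gamma_lim] by simp
    show "((\<lambda>t. - x t) \<longlongrightarrow> 0) at_top"
      using tendsto_minus[OF x_lim] by simp
  qed
  have abs_ratio: "\<forall>\<^sub>F t in at_top. \<bar>x t / y t\<bar> = \<bar>x t\<bar> / y t"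
    using eventually_ge_at_top[of 0] by eventually_elim (simp add: abs_divide y_pos abs_of_pos)
  show ?thesis
  proof (cases "((\<lambda>t. \<bar>x t\<bar> / y t) \<longlongrightarrow> 0) at_top")
    case True
    then show ?thesis
      by blast
  next
    case False
    then obtain \<eta> where "\<eta> > 0" and "\<exists>\<^sub>F t in at_top. \<eta> \<le> \<bar>\<bar>x t\<bar> / y t\<bar>"
      by (auto simp: tendsto_iff frequently_def not_le)
    then have "\<exists>\<^sub>F t in at_top. \<eta> \<le> \<bar>\<bar>x t\<bar> / y t\<bar> \<and> t \<ge> 0"
      using frequently_eventually_frequently eventually_ge_at_top by blast
    then have "\<exists>\<^sub>F t in at_top. \<eta> * y t \<le> x t \<or> \<eta> * y t \<le> - x t"
    proof (rule frequently_mono[rotated], intro allI impI)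
      fix t assume t: "\<eta> \<le> \<bar>\<bar>x t\<bar> / y t\<bar> \<and> t \<ge> 0"
      then have "y t > 0"
        by (simp add: y_pos)
      with t have "\<eta> * y t \<le> \<bar>x t\<bar>"
        by (simp add: abs_divide pos_le_divide_eq)
      then show "\<eta> * y t \<le> x t \<or> \<eta> * y t \<le> - x t"
        by linarith
    qed
    then have "((\<lambda>t. x t / y t) \<longlongrightarrow> 1) at_top \<or> ((\<lambda>t. - x t / y t) \<longlongrightarrow> 1) at_top"
      using upper[OF \<open>\<eta> > 0\<close>] lower[OF \<open>\<eta> > 0\<close>] by (auto simp: frequently_disj_iff)
    then have "((\<lambda>t. \<bar>x t / y t\<bar>) \<longlongrightarrow> 1) at_top"
      by (auto dest: tendsto_rabs)
    then have "((\<lambda>t. \<bar>x t\<bar> / y t) \<longlongrightarrow> 1) at_top"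
      by (rule Lim_transform_eventually[OF _ abs_ratio])
    then show ?thesis
      by blast
  qed
qed

end
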